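(* For all $i,j\in\mathbb{N}$, the following relations hold in $\mathbb{V}$: $$\frac{(xC^{s}_i)\star C^{s}_j-C^{s}_j\star(xC^{s}_i)}{q^2-q^{-2}}=\sum_{\ell=1}^{j}(-1)^{\ell}q^{2-2\ell}\,(xC^{s}_{i+\ell})\star C^{s}_{j-\ell},$$ $$\frac{C^{s}_j\star(C^{s}_iy)-(C^{s}_iy)\star C^{s}_j}{q^2-q^{-2}}=\sum_{\ell=1}^{j}(-1)^{\ell}q^{2-2\ell}\,C^{s}_{j-\ell}\star(C^{s}_{i+\ell}y).$$
   Context: Ground field $\mathbb{F}=\mathbb{Q}(q)$, $q$ an indeterminate; $\mathbb{N}=\{0,1,2,\ldots\}$; $\{n\}_q=\frac{q^{-n}-(-1)^nq^n}{q+q^{-1}}$. $\mathbb{V}$ is the free associative unital $\mathbb{F}$-algebra on noncommuting $x,y$; words form a basis; the empty word is $1$; juxtaposition denotes concatenation. The $q$-shuffle superproduct $\star$ is the bilinear associative product on $\mathbb{V}$ with $1\star v=v\star1=v$ and, for nontrivial words $u=u_1\cdots u_r$, $v=v_1\cdots v_s$, recursively $$u\star v=u_1\big((u_2\cdots u_r)\star v\big)+(-1)^r v_1\big(u\star(v_2\cdots v_s)\big)q^{\langle u_1,v_1\rangle+\cdots+\langle u_r,v_1\rangle},$$ where $\langle x,x\rangle=\langle y,y\rangle=2$, $\langle x,y\rangle=\langle y,x\rangle=-2$. Catalan elements: put $\bar x=1$, $\bar y=-1$. A word $a_1\cdots a_m$ is Catalan if $\bar a_1+\cdots+\bar a_m=0$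 and $\bar a_1+\cdots+\bar a_i\ge0$ for all $1\le i\le m$. $\mathrm{Cat}_n$ is the set of Catalan words of length $2n$. Define $C^s(1)=1$, and for $n\ge1$, $w\in\mathrm{Cat}_n$, $$C^{s}(w)=\sum_{v\in\mathrm{Cat}_{n-1}}C^{s}(v)\sum_i(-1)^i\{2+2\bar a_1+\cdots+2\bar a_i\}_q,$$ where, for $v=a_1\cdots a_m$ ($m=2n-2$), the inner sum is over the $i$, $0\le i\le m$, such that $w=a_1\cdots a_i\,x\,a_{i+1}\cdots a_m\,y$. Set $C^{s}_n=\sum_{w\in\mathrm{Cat}_n}C^s(w)\,w\in\mathbb{V}$ (so $C^s_0=1$, $C^s_1=\{2\}_qxy$). $xC^s_n$, $C^s_ny$ are concatenation products. *)

theory Defs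
  imports "HOL-Computational_Algebra.Computational_Algebra" "HOL-Library.Poly_Mapping"
begin

type_synonym Fq = "rat poly fract"

definition q :: Fq where
  "q = Fract [:0, 1:] 1"

definition brace :: "int \<Rightarrow> Fq" where
  "brace n = (q powi (- n) - (-1) powi n * q powi n) / (q + q powi (-1))"

datatype letter = X | Y

type_synonym word = "letter list"

(* Lists form the free monoid, written additively.  With this instance the library's
   convolution product * on finitely supported functions on words is the bilinear
   extension of concatenation, and 1 is the empty word. *)
instantiation list :: (type) monoid_add
begin

definition zero_list :: "'a list" where
  "zero_list = []"

definition plus_list :: "'a list \<Rightarrow> 'a list \<Rightarrow> 'a list" where
  "plus_list u v = u @ v"

instance
  by standard (simp_all add: zero_list_def plus_list_def)

end

type_synonym V = "word \<Rightarrow>\<^sub>0 Fq"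

definition word :: "word \<Rightarrow> V" where
  "word w = Poly_Mapping.single w 1"

definition scale :: "Fq \<Rightarrow> V \<Rightarrow> V" where
  "scale c v = Poly_Mapping.map ((*) c) v"

lemma lookup_scale: "Poly_Mapping.lookup (scale c v) w = c * Poly_Mapping.lookup v w"
  by (simp add: scale_def Poly_Mapping.map.rep_eq when_def)

lemma word_Nil: "word [] = 1"
  by (simp add: word_def zero_list_def[symmetric])

lemma word_mult: "word u * word v = word (u @ v)"
  by (simp add: word_def mult_single plus_list_def)

definition form :: "letter \<Rightarrow> letter \<Rightarrow> int" where
  "form a b = (if a = b then 2 else - 2)"

fun word_shuffle :: "word \<Rightarrow> word \<Rightarrow> V" where
  "word_shuffle [] v = word v"
| "word_shuffle u [] = word u"
| "word_shuffle (a # u) (b # v) =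
     word [a] * word_shuffle u (b # v) +
     scale ((-1) ^ length (a # u) * q powi (\<Sum>c\<leftarrow>a # u. form c b))
       (word [b] * word_shuffle (a # u) v)"

definition qshuffle :: "V \<Rightarrow> V \<Rightarrow> V" (infixl \<open>\<star>\<close> 70) where
  "f \<star> g = (\<Sum>u\<in>Poly_Mapping.keys f. \<Sum>v\<in>Poly_Mapping.keys g.
     scale (Poly_Mapping.lookup f u * Poly_Mapping.lookup g v) (word_shuffle u v))"

fun wt :: "letter \<Rightarrow> int" where
  "wt X = 1"
| "wt Y = - 1"

definition height :: "word \<Rightarrow> int" where
  "height w = (\<Sum>a\<leftarrow>w. wt a)"

definition is_catalan :: "word \<Rightarrow> bool" where
  "is_catalan w \<longleftrightarrow> height w = 0 \<and> (\<forall>i\<in>{1..length w}. 0 \<le> height (take i w))"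

definition Cat :: "nat \<Rightarrow> word set" where
  "Cat n = {w. is_catalan w \<and> length w = 2 * n}"

lemma finite_Cat: "finite (Cat n)"
proof (rule finite_subset)
  have "(UNIV :: letter set) = {X, Y}"
    using letter.exhaust by auto
  then have "finite (UNIV :: letter set)"
    by (metis finite.emptyI finite_insert)
  then show "finite {w :: word. set w \<subseteq> UNIV \<and> length w = 2 * n}"
    by (rule finite_lists_length_eq)
qed (auto simp: Cat_def)

(* Cs_coeff n w is the coefficient attached to a word w in Cat n; its values at
   other words are irrelevant. *)
primrec Cs_coeff :: "nat \<Rightarrow> word \<Rightarrow> Fq" where
  "Cs_coeff 0 w = 1"
| "Cs_coeff (Suc n) w = (\<Sum>v\<in>Cat n. Cs_coeff n v *
     (\<Sum>i\<in>{i. i \<le> length v \<and> w = take i v @ [X] @ drop i v @ [Y]}.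
        (-1) ^ i * brace (2 + 2 * height (take i v))))"

definition Cs :: "nat \<Rightarrow> V" where
  "Cs n = (\<Sum>w\<in>Cat n. scale (Cs_coeff n w) (word w))"

end

theory Submission
  imports Defs
begin

text \<open>Write $X_n$ for the concatenation product $xC^s_n$, and let juxtaposition denote the shuffle
product. The first identity is obtained by iterating the two-term exchange relation
\[ X_i C_{j+1} - C_{j+1} X_i = q^{-2} C_j X_{i+1} - q^2 X_{i+1} C_j \]
(lemma \<open>commutator_xroot_Cs\<close>), whose right-hand side contains a commutator with smaller $j$.
The second identity is the image of the first under the antiautomorphism \<open>zeta\<close> that
reverses words and swaps the letters.

Two facts make the exchange relation accessible. An element of \<open>V\<close> is determined by its constant
coefficient and by its two right derivatives, which delete a last letter $x$ or $y$; and these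
are skew derivations of the shuffle product (lemma \<open>rdel_qshuffle\<close>). On the other hand, inserting
one $x$ everywhere into a word is a shuffle with $x$, so the recursion for the Catalan coefficients
says that the derivative of $C_{n+1}$ with respect to $y$ is
$(q^{-2} C_n x - q^2 x C_n)/(q+q^{-1})$, while its derivative with respect to $x$ is zero (lemma
\<open>rdel_Cs\<close>). The derivatives of $X_{n+1}$ are quadratic expressions of the same kind. Thus
relations among the $X_n$ and $C_n$ can be proved by differentiating and using relations of smaller
degree.

Differentiating alone leads to an induction in which the exchange relation and the quadratic
relations
\[ X_{a+1}X_b + q^{-2}X_bX_{a+1} + X_{b+1}X_a + q^{-2}X_aX_{b+1} = 0 \]
are intertwined. The following detour separates them. Let \<open>Xit n\<close> be the elements produced from $x$
by iterating the commutator with $C_1$ (suitably scaled), and let \<open>Ccomm n\<close> be the $q$-anticommutator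
of \<open>Xit n\<close> with $y$. One derivative computation each gives the quadratic relation with $a=b=0$ and
the vanishing of the commutator of $C_1$ with \<open>Ccomm 1\<close>. The commutators with $C_1$ and with
\<open>Heis\<close>, a combination of \<open>Ccomm 1\<close> and $C_1^2$, raise the index of \<open>Xit\<close> by one and by two. On a
product of two factors these index shifts act like the power sums $z+w$ and $z^2+w^2$, which
generate all symmetric polynomials, so the single quadratic relation spreads to all of them (lemma
\<open>quad_rel_0\<close>). With these relations the derivatives of \<open>Xit n\<close> and of \<open>Ccomm n\<close> come out the same as
those of $X_n$ and $C_{n+1}$, and hence the elements agree.

Finally, writing $C_{m+1}$ as the $q$-anticommutator of $X_m$ with $y$ shows that the exchange relations for
$(i,j)$ and for $(j-1,i+1)$ hold in sum. For $i=0$ the second one is the case already known from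
\<open>Ccomm 1\<close>, so the relation for $i=0$ follows. That relation is equivalent to $C_1$ commuting with
$C_{j+1}$, and then the commutator with $C_1$ raises $i$.\<close>

section \<open>The vector space on words\<close>

lemma scale_simps [simp]:
  "scale c 0 = 0" "scale 0 f = 0" "scale 1 f = f"
  "scale a (scale b f) = scale (a * b) f" "scale (- 1) f = - f"
  by (auto intro!: poly_mapping_eqI simp: lookup_scale mult.assoc)

lemma scale_add: "scale c (f + g) = scale c f + scale c g"
  by (auto intro!: poly_mapping_eqI simp: lookup_scale lookup_add algebra_simps)

lemma scale_minus: "scale c (- f) = - scale c f"
  by (auto intro!: poly_mapping_eqI simp: lookup_scale)

lemma scale_diff: "scale c (f - g) = scale c f - scale c g"
  by (auto intro!: poly_mapping_eqI simp: lookup_scale lookup_minus right_diff_distrib)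

lemma scale_left_add: "scale (a + b) f = scale a f + scale b f"
  by (auto intro!: poly_mapping_eqI simp: lookup_scale lookup_add algebra_simps)

lemma scale_sum: "scale c (\<Sum>i\<in>A. f i) = (\<Sum>i\<in>A. scale c (f i))"
  by (auto intro!: poly_mapping_eqI simp: lookup_scale lookup_sum sum_distrib_left)

lemma scale_eq_0_iff: "scale c f = 0 \<longleftrightarrow> c = 0 \<or> f = 0"
  by (auto simp: poly_mapping_eq_iff lookup_scale fun_eq_iff)

lemma lookup_word: "Poly_Mapping.lookup (word u) v = (if u = v then 1 else 0)"
  by (simp add: word_def lookup_single when_def)

lemma word_expansion:
  "f = (\<Sum>u\<in>Poly_Mapping.keys f. scale (Poly_Mapping.lookup f u) (word u))"
  by (rule poly_mapping_eqI)
    (auto simp: lookup_sum lookup_scale lookup_word in_keys_iff if_distrib cong: if_cong)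

text \<open>Linearity reduces an identity between elements of \<open>V\<close> to words. The closure under \<open>scale\<close> provides
the case of zero.\<close>

lemma V_induct [case_names add scale word]:
  assumes add: "\<And>f g. P f \<Longrightarrow> P g \<Longrightarrow> P (f + g)"
    and scale: "\<And>c f. P f \<Longrightarrow> P (scale c f)"
    and word: "\<And>u. P (word u)"
  shows "P f"
proof -
  have "P (\<Sum>u\<in>A. scale (Poly_Mapping.lookup f u) (word u))" if "finite A" for A
    using that
  proof (induction A rule: finite_induct)
    case empty
    show ?case using scale[OF word, of 0] by simp
  qed (simp add: add scale word)
  then show ?thesis
    by (subst word_expansion) simp
qed

lemma scale_word: "scale c (word v) = Poly_Mapping.single v c"
  by (auto intro!: poly_mapping_eqI simp: word_def lookup_scale lookup_single when_def)

text \<open>Scalars are the central elements supported on the empty word, so the laws for products with scaled factors are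
instances of associativity.\<close>

lemma scale_eq_mult:
  "scale c f = Poly_Mapping.single 0 c * f" "scale c f = f * Poly_Mapping.single 0 c"
proof (induction f arbitrary: c rule: V_induct)
  case (scale d f)
  { case 1
    have "scale c (scale d f) = Poly_Mapping.single 0 (c * d) * f"
      using scale(1)[of "c * d"] by simp
    also have "\<dots> = Poly_Mapping.single 0 c * scale d f"
      using scale(1)[of d] by (simp add: mult_single flip: mult.assoc)
    finally show ?case . }
  { case 2
    have "scale c (scale d f) = f * Poly_Mapping.single 0 (d * c)"
      using scale(2)[of "c * d"] by (simp add: mult.commute)
    also have "\<dots> = scale d f * Poly_Mapping.single 0 c"
      using scale(2)[of d] by (simp add: mult_single mult.assoc)
    finally show ?case . }
next
  case (word u)
  { case 1 show ?case by (simp add: scale_word, simp add: word_def mult_single) }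
  { case 2 show ?case by (simp add: scale_word, simp add: word_def mult_single) }
next
  case (add f g)
  { case 1 show ?case by (simp add: scale_add distrib_left add(1,3)) }
  { case 2 show ?case by (simp add: scale_add distrib_right add(2,4)) }
qed

lemma scale_mult_left: "scale c f * g = scale c (f * g)" for f g :: V
  by (simp add: scale_eq_mult(1) mult.assoc)

lemma scale_mult_right: "f * scale c g = scale c (f * g)" for f g :: V
  by (simp add: scale_eq_mult(2) mult.assoc)

section \<open>Bilinearity of the shuffle product\<close>

text \<open>The support of a sum is not the union of the supports; summation over a common finite superset
makes bilinearity a matter of distributivity.\<close>

lemma qshuffle_superset:
  assumes "finite A" "finite B" "Poly_Mapping.keys f \<subseteq> A" "Poly_Mapping.keys g \<subseteq> B"
  shows "f \<star> g = (\<Sum>u\<in>A. \<Sum>v\<in>B.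
    scale (Poly_Mapping.lookup f u * Poly_Mapping.lookup g v) (word_shuffle u v))"
proof -
  have "f \<star> g = (\<Sum>u\<in>Poly_Mapping.keys f. \<Sum>v\<in>B.
    scale (Poly_Mapping.lookup f u * Poly_Mapping.lookup g v) (word_shuffle u v))"
    unfolding qshuffle_def using assms
    by (intro sum.cong sum.mono_neutral_left) (auto simp: in_keys_iff)
  also have "\<dots> = (\<Sum>u\<in>A. \<Sum>v\<in>B.
    scale (Poly_Mapping.lookup f u * Poly_Mapping.lookup g v) (word_shuffle u v))"
    using assms by (intro sum.mono_neutral_left) (auto simp: in_keys_iff)
  finally show ?thesis .
qed

lemma qshuffle_add_left: "(f + g) \<star> h = f \<star> h + g \<star> h"
proof -
  let ?A = "Poly_Mapping.keys f \<union> Poly_Mapping.keys g" and ?B = "Poly_Mapping.keys h"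
  have "Poly_Mapping.keys (f + g) \<subseteq> ?A" by (rule Poly_Mapping.keys_add)
  then show ?thesis
    by (subst (1 2 3) qshuffle_superset[of ?A ?B])
      (auto simp: lookup_add distrib_right scale_left_add sum.distrib)
qed

lemma qshuffle_add_right: "h \<star> (f + g) = h \<star> f + h \<star> g"
proof -
  let ?A = "Poly_Mapping.keys f \<union> Poly_Mapping.keys g" and ?B = "Poly_Mapping.keys h"
  have "Poly_Mapping.keys (f + g) \<subseteq> ?A" by (rule Poly_Mapping.keys_add)
  then show ?thesis
    by (subst (1 2 3) qshuffle_superset[of ?B ?A])
      (auto simp: lookup_add distrib_left scale_left_add sum.distrib)
qed

lemma qshuffle_scale_left: "scale c f \<star> g = scale c (f \<star> g)"
proof -
  have "Poly_Mapping.keys (scale c f) \<subseteq> Poly_Mapping.keys f"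
    by (auto simp: in_keys_iff lookup_scale)
  then show ?thesis
    by (subst (1 2) qshuffle_superset[of "Poly_Mapping.keys f" "Poly_Mapping.keys g"])
      (auto simp: scale_sum lookup_scale mult.assoc)
qed

lemma qshuffle_scale_right: "f \<star> scale c g = scale c (f \<star> g)"
proof -
  have "Poly_Mapping.keys (scale c g) \<subseteq> Poly_Mapping.keys g"
    by (auto simp: in_keys_iff lookup_scale)
  then show ?thesis
    by (subst (1 2) qshuffle_superset[of "Poly_Mapping.keys f" "Poly_Mapping.keys g"])
      (auto simp: scale_sum lookup_scale ac_simps)
qed

lemma qshuffle_minus_left: "(- f) \<star> g = - (f \<star> g)"
  using qshuffle_scale_left[of "-1" f g] by simp

lemma qshuffle_minus_right: "f \<star> (- g) = - (f \<star> g)"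
  using qshuffle_scale_right[of f "-1" g] by simp

lemma qshuffle_diff_left: "(f - g) \<star> h = f \<star> h - g \<star> h"
  using qshuffle_add_left[of f "- g" h] by (simp add: qshuffle_minus_left)

lemma qshuffle_diff_right: "h \<star> (f - g) = h \<star> f - h \<star> g"
  using qshuffle_add_right[of h f "- g"] by (simp add: qshuffle_minus_right)

lemma qshuffle_zero [simp]: "0 \<star> f = 0" "f \<star> 0 = 0"
  using qshuffle_scale_left[of 0 0 f] qshuffle_scale_right[of f 0 0] by simp_all

lemma qshuffle_word: "word u \<star> word v = word_shuffle u v"
  by (subst qshuffle_superset[of "{u}" "{v}"]) (auto simp: in_keys_iff lookup_word split: if_splits)

lemma word_shuffle_Nil_right: "word_shuffle u [] = word u"
  by (cases u) simp_all

lemma qshuffle_one [simp]: "1 \<star> f = f" "f \<star> 1 = f"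
  by (induction f rule: V_induct,
      simp_all add: qshuffle_add_left qshuffle_add_right qshuffle_scale_left qshuffle_scale_right
        qshuffle_word word_shuffle_Nil_right flip: word_Nil)

section \<open>Removing letters\<close>

definition ldel :: "letter \<Rightarrow> V \<Rightarrow> V" where
  "ldel a f = Poly_Mapping.map_key (\<lambda>w. a # w) f"

definition rdel :: "letter \<Rightarrow> V \<Rightarrow> V" where
  "rdel a f = Poly_Mapping.map_key (\<lambda>w. w @ [a]) f"

text \<open>The factor that appears when the letter moves to the left across the whole word.\<close>

definition bichar :: "word \<Rightarrow> letter \<Rightarrow> Fq" where
  "bichar w a = (- 1) ^ length w * q powi (\<Sum>c\<leftarrow>w. form c a)"

definition twist :: "letter \<Rightarrow> V \<Rightarrow> V" where
  "twist a f = Poly_Mapping.mapp (\<lambda>w c. bichar w a * c) f"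

definition const_coeff :: "V \<Rightarrow> Fq" where
  "const_coeff f = Poly_Mapping.lookup f []"

lemma lookup_ldel: "Poly_Mapping.lookup (ldel a f) w = Poly_Mapping.lookup f (a # w)"
  by (simp add: ldel_def map_key.rep_eq inj_on_def)

lemma lookup_rdel: "Poly_Mapping.lookup (rdel a f) w = Poly_Mapping.lookup f (w @ [a])"
  by (simp add: rdel_def map_key.rep_eq inj_on_def)

lemma lookup_twist: "Poly_Mapping.lookup (twist a f) w = bichar w a * Poly_Mapping.lookup f w"
  by (auto simp: twist_def lookup_mapp when_def in_keys_iff)

lemmas V_eq_simps = lookup_ldel lookup_rdel lookup_twist lookup_scale lookup_add lookup_minus
  lookup_word const_coeff_def

lemma ldel_linear [simp]:
  "ldel a (f + g) = ldel a f + ldel a g" "ldel a (f - g) = ldel a f - ldel a g"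
  "ldel a (- f) = - ldel a f"
  "ldel a (scale c f) = scale c (ldel a f)" "ldel a 0 = 0"
  by (auto intro!: poly_mapping_eqI simp: V_eq_simps)

lemma rdel_linear [simp]:
  "rdel a (f + g) = rdel a f + rdel a g" "rdel a (f - g) = rdel a f - rdel a g"
  "rdel a (- f) = - rdel a f"
  "rdel a (scale c f) = scale c (rdel a f)" "rdel a 0 = 0"
  by (auto intro!: poly_mapping_eqI simp: V_eq_simps)

lemma twist_linear [simp]:
  "twist a (f + g) = twist a f + twist a g" "twist a (f - g) = twist a f - twist a g"
  "twist a (- f) = - twist a f"
  "twist a (scale c f) = scale c (twist a f)" "twist a 0 = 0"
  by (auto intro!: poly_mapping_eqI simp: V_eq_simps algebra_simps)

lemma const_linear [simp]:
  "const_coeff (f + g) = const_coeff f + const_coeff g"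
  "const_coeff (f - g) = const_coeff f - const_coeff g"
  "const_coeff (- f) = - const_coeff f"
  "const_coeff (scale c f) = c * const_coeff f" "const_coeff 0 = 0"
  by (auto simp: V_eq_simps)

lemma ldel_word [simp]:
  "ldel a (word []) = 0" "ldel a (word (b # w)) = (if a = b then word w else 0)"
  by (auto intro!: poly_mapping_eqI simp: V_eq_simps)

lemma rdel_word [simp]:
  "rdel a (word []) = 0" "rdel a (word (w @ [b])) = (if a = b then word w else 0)"
  by (auto intro!: poly_mapping_eqI simp: V_eq_simps)

lemma twist_word [simp]: "twist a (word w) = scale (bichar w a) (word w)"
  by (auto intro!: poly_mapping_eqI simp: V_eq_simps)

lemma const_word [simp]: "const_coeff (word w) = (if w = [] then 1 else 0)"
  by (simp add: V_eq_simps)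

lemma ldel_letter_mult [simp]: "ldel a (word [b] * f) = (if a = b then f else 0)"
  by (induction f rule: V_induct) (simp_all add: distrib_left scale_mult_right word_mult)

lemma rdel_mult_letter [simp]: "rdel a (f * word [b]) = (if a = b then f else 0)"
  by (induction f rule: V_induct) (simp_all add: distrib_right scale_mult_left word_mult)

lemma const_letter_mult [simp]: "const_coeff (word [b] * f) = 0" "const_coeff (f * word [b]) = 0"
  by (induction f rule: V_induct)
    (simp_all add: distrib_right distrib_left scale_mult_left scale_mult_right word_mult)

lemma one_less_q: "1 < q"
  by (simp add: q_def one_less_Fract_iff less_poly_def pos_poly_def one_pCons)

lemma q_nonzero [simp]: "q \<noteq> 0"
  using one_less_q by auto

lemma bichar_Nil [simp]: "bichar [] a = 1"
  by (simp add: bichar_def)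

lemma bichar_append: "bichar (u @ v) a = bichar u a * bichar v a"
  by (simp add: bichar_def power_add power_int_add)

lemma bichar_Cons: "bichar (b # u) a = bichar [b] a * bichar u a"
  using bichar_append[of "[b]" u a] by simp

lemma bichar_letter: "bichar [b] a = (if a = b then - (q ^ 2) else - (q powi (-2)))"
  by (auto simp: bichar_def form_def)

lemma bichar_commute: "bichar [b] a = bichar [a] b"
  by (auto simp: bichar_letter)

lemma one_simps [simp]: "ldel a 1 = 0" "rdel a 1 = 0" "twist a 1 = 1" "const_coeff 1 = 1"
  by (simp_all flip: word_Nil)

text \<open>Every nonempty word has a first letter and a last letter, so either family of derivatives together with
the constant coefficient separates elements.\<close>

lemma V_eqI_ldel:
  assumes "const_coeff f = const_coeff g" "\<And>a. ldel a f = ldel a g"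
  shows "f = g"
proof (rule poly_mapping_eqI)
  fix w show "Poly_Mapping.lookup f w = Poly_Mapping.lookup g w"
  proof (cases w)
    case Nil
    then show ?thesis using assms(1) by (simp add: const_coeff_def)
  next
    case (Cons a v)
    then show ?thesis using assms(2)[of a] by (metis lookup_ldel)
  qed
qed

lemma V_eqI_rdel:
  assumes "const_coeff f = const_coeff g" "\<And>a. rdel a f = rdel a g"
  shows "f = g"
proof (rule poly_mapping_eqI)
  fix w show "Poly_Mapping.lookup f w = Poly_Mapping.lookup g w"
  proof (cases w rule: rev_cases)
    case Nil
    then show ?thesis using assms(1) by (simp add: const_coeff_def)
  next
    case (snoc v a)
    then show ?thesis using assms(2)[of a] by (metis lookup_rdel)
  qed
qed

lemmas qshuffle_linear =
  qshuffle_add_left qshuffle_add_right qshuffle_diff_left qshuffle_diff_right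
  qshuffle_scale_left qshuffle_scale_right qshuffle_minus_left qshuffle_minus_right

section \<open>Skew derivations and associativity\<close>

text \<open>The recursion for the shuffle product of words, read as a statement about the first letter: if it
comes from the second factor, it has crossed the whole first factor.\<close>

lemma ldel_qshuffle: "ldel a (f \<star> g) = ldel a f \<star> g + twist a f \<star> ldel a g"
proof (induction f rule: V_induct)
  case (word u)
  show ?case
  proof (induction g rule: V_induct)
    case (word v)
    show ?case
    proof (cases u)
      case Nil
      then show ?thesis by (simp add: word_Nil)
    next
      case u: (Cons b u')
      show ?thesis
      proof (cases v)
        case Nil
        then show ?thesis by (simp add: word_Nil)
      next
        case (Cons d v')
        then show ?thesis
          by (simp add: u qshuffle_word bichar_def qshuffle_linear)
      qed
    qed
  qed (simp_all add: qshuffle_linear scale_add algebra_simps)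
qed (simp_all add: qshuffle_linear scale_add algebra_simps)

lemma const_qshuffle [simp]: "const_coeff (f \<star> g) = const_coeff f * const_coeff g"
proof (induction f rule: V_induct)
  case (word u)
  show ?case
  proof (induction g rule: V_induct)
    case (word v)
    show ?case by (cases u; cases v) (simp_all add: qshuffle_word)
  qed (simp_all add: qshuffle_linear algebra_simps)
qed (simp_all add: qshuffle_linear algebra_simps)

lemma twist_letter_mult: "twist a (word [b] * f) = scale (bichar [b] a) (word [b] * twist a f)"
proof (induction f rule: V_induct)
  case (word u)
  show ?case
    using bichar_Cons[of b u a] by (simp add: word_mult scale_mult_right)
qed (simp_all add: distrib_left scale_mult_right scale_add mult.commute)

text \<open>All words in a shuffle of two words have the same letters, and \<open>bichar\<close> depends only on these.\<close>

lemma twist_qshuffle: "twist a (f \<star> g) = twist a f \<star> twist a g"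
proof (induction f rule: V_induct)
  case (word u)
  show ?case
  proof (induction g rule: V_induct)
    case (word v)
    show ?case unfolding twist_word qshuffle_linear qshuffle_word
    proof (induction u v rule: word_shuffle.induct)
      case (3 b u d v)
      then show ?case
        by (simp add: twist_letter_mult scale_add scale_mult_right
            bichar_Cons[of b u] bichar_Cons[of d v] ac_simps)
    qed simp_all
  qed (simp_all add: qshuffle_linear scale_add)
qed (simp_all add: qshuffle_linear scale_add)

lemma ldel_word_cases:
  obtains "ldel a (word u) = 0" | u' where "u = a # u'" "ldel a (word u) = word u'"
proof (cases "\<exists>u'. u = a # u'")
  case False
  then have "ldel a (word u) = 0" by (cases u) auto
  then show thesis by (rule that)
qed (use that in auto)

text \<open>Both sides satisfy the same rule for left derivatives, and the derivatives involve shorter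
words.\<close>

lemma qshuffle_assoc_word: "(word u \<star> word v) \<star> word w = word u \<star> (word v \<star> word w)"
proof (induction "length u + length v + length w" arbitrary: u v w rule: less_induct)
  case less
  have u: "(ldel a (word u) \<star> word v) \<star> word w = ldel a (word u) \<star> (word v \<star> word w)" for a
    by (rule ldel_word_cases[of a u]) (auto intro!: less)
  have v: "(word u \<star> ldel a (word v)) \<star> word w = word u \<star> (ldel a (word v) \<star> word w)" for a
    by (rule ldel_word_cases[of a v]) (auto intro!: less)
  have w: "(word u \<star> word v) \<star> ldel a (word w) = word u \<star> (word v \<star> ldel a (word w))" for a
    by (rule ldel_word_cases[of a w]) (auto intro!: less)
  show ?case
    by (rule V_eqI_ldel)
      (simp_all add: ldel_qshuffle twist_qshuffle qshuffle_linear u v w scale_add algebra_simps del: ldel_word)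
qed

lemma qshuffle_assoc: "(f \<star> g) \<star> h = f \<star> (g \<star> h)"
proof (induction f rule: V_induct)
  case (word u)
  show ?case
  proof (induction g rule: V_induct)
    case (word v)
    show ?case by (induction h rule: V_induct) (simp_all add: qshuffle_linear qshuffle_assoc_word)
  qed (simp_all add: qshuffle_linear)
qed (simp_all add: qshuffle_linear)

lemma ldel_rdel: "ldel b (rdel a f) = rdel a (ldel b f)"
  by (rule poly_mapping_eqI) (simp add: lookup_ldel lookup_rdel)

lemma const_rdel: "const_coeff (rdel a f) = const_coeff (ldel a f)"
  by (simp add: const_coeff_def lookup_ldel lookup_rdel)

lemma const_twist [simp]: "const_coeff (twist a f) = const_coeff f"
  by (simp add: const_coeff_def lookup_twist)

lemma rdel_twist: "rdel a (twist b f) = scale (bichar [a] b) (twist b (rdel a f))"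
  by (rule poly_mapping_eqI) (simp add: lookup_twist lookup_rdel lookup_scale bichar_append)

lemma ldel_twist: "ldel a (twist b f) = scale (bichar [a] b) (twist b (ldel a f))"
  by (rule poly_mapping_eqI) (simp add: lookup_twist lookup_ldel lookup_scale, metis bichar_Cons mult.assoc)

text \<open>The recursion describes first letters. The rule for last letters follows because left and right
derivatives commute, so that both sides have the same left derivatives by induction.\<close>

lemma rdel_qshuffle_word:
  "rdel a (word u \<star> word v) = word u \<star> rdel a (word v) + rdel a (word u) \<star> twist a (word v)"
proof (induction "length u + length v" arbitrary: u v rule: less_induct)
  case less
  have u: "rdel a (ldel b (word u) \<star> word v) =
      ldel b (word u) \<star> rdel a (word v) + rdel a (ldel b (word u)) \<star> twist a (word v)" for b
    by (rule ldel_word_cases[of b u], simp, simp only:, subst less, auto)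
  have v: "rdel a (word u \<star> ldel b (word v)) =
      word u \<star> rdel a (ldel b (word v)) + rdel a (word u) \<star> twist a (ldel b (word v))" for b
    by (rule ldel_word_cases[of b v], simp, simp only:, subst less, auto)
  show ?case
  proof (rule V_eqI_ldel)
    fix b
    show "ldel b (rdel a (word u \<star> word v)) =
      ldel b (word u \<star> rdel a (word v) + rdel a (word u) \<star> twist a (word v))"
    proof -
      have e: "scale (bichar u b) (rdel a (word u)) = scale (bichar [b] a) (twist b (rdel a (word u)))"
        using rdel_twist[of a b "word u"] by (simp add: bichar_commute)
      have "ldel b (rdel a (word u \<star> word v)) =
          rdel a (ldel b (word u) \<star> word v) + scale (bichar u b) (rdel a (word u \<star> ldel b (word v)))"
        by (simp add: ldel_rdel ldel_qshuffle qshuffle_linear del: ldel_word)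
      also have "\<dots> = ldel b (word u) \<star> rdel a (word v) + ldel b (rdel a (word u)) \<star> twist a (word v)
          + twist b (word u) \<star> ldel b (rdel a (word v))
          + scale (bichar u b) (rdel a (word u)) \<star> twist a (ldel b (word v))"
        unfolding u v by (simp add: ldel_rdel qshuffle_linear scale_add del: ldel_word)
      also have "scale (bichar u b) (rdel a (word u)) \<star> twist a (ldel b (word v))
          = twist b (rdel a (word u)) \<star> ldel b (twist a (word v))"
        by (simp only: e ldel_twist qshuffle_linear)
      finally show ?thesis
        by (simp only: ldel_linear ldel_qshuffle add_ac)
    qed
  qed (simp add: const_rdel ldel_qshuffle del: ldel_word)
qed

lemma rdel_qshuffle: "rdel a (f \<star> g) = f \<star> rdel a g + rdel a f \<star> twist a g"
proof (induction f rule: V_induct)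
  case (word u)
  show ?case
    by (induction g rule: V_induct)
      (simp_all add: qshuffle_linear rdel_qshuffle_word scale_add algebra_simps del: twist_word)
qed (simp_all add: qshuffle_linear scale_add algebra_simps)

section \<open>Catalan elements\<close>

text \<open>With separate names for \<open>q ^ 2\<close>, its inverse, and the factor \<open>nrm\<close> that comes from the denominator of \<open>brace\<close>,
the coefficient identities that arise from expanding shuffle products are polynomial identities modulo
\<open>q2i * q2 = 1\<close>.\<close>

definition q2 :: Fq where "q2 = q ^ 2"
definition q2i :: Fq where "q2i = q powi (-2)"
definition nrm :: Fq where "nrm = 1 / (q + q powi (-1))"

lemma q2i_q2 [simp]: "q2i * q2 = 1" "q2 * q2i = 1"
  by (simp_all add: q2i_def q2_def power_int_minus)

lemma nrm_nonzero [simp]: "nrm \<noteq> 0"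
proof -
  have "0 < q" using one_less_q by (rule less_trans[rotated]) simp
  then have "0 < q + q powi (-1)" by (intro add_pos_pos) simp_all
  then show ?thesis by (simp add: nrm_def)
qed

lemma height_simps [simp]:
  "height [] = 0" "height (a # w) = wt a + height w" "height (u @ v) = height u + height v"
  by (simp_all add: height_def)

lemma bichar_X: "bichar w X = (- 1) ^ length w * q powi (2 * height w)"
proof -
  have "form a X = 2 * wt a" for a by (cases a) (simp_all add: form_def)
  then have "(\<Sum>a\<leftarrow>w. form a X) = 2 * height w"
    by (simp add: height_def sum_list_const_mult)
  then show ?thesis by (simp add: bichar_def)
qed

lemma form_commute: "form a b = form b a"
  by (simp add: form_def)

text \<open>Shuffling with a single letter inserts it at every position. The letter crosses the part of the word
to its left in a product from the left, and is crossed by the part to its right in a product from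
the right; hence the prefix in one coefficient and the suffix in the other.\<close>

lemma word_shuffle_letter_left:
  "word_shuffle [a] v = (\<Sum>i\<le>length v. scale (bichar (take i v) a) (word (take i v @ [a] @ drop i v)))"
proof (induction v)
  case (Cons b v)
  have "bichar [b] a = - (q powi form a b)"
    by (simp add: bichar_def form_commute)
  then have "scale (bichar [b] a) (word [b] * word_shuffle [a] v)
    = (\<Sum>i\<le>length v. scale (bichar (b # take i v) a) (word (b # take i v @ [a] @ drop i v)))"
    unfolding Cons by (simp add: sum_distrib_left scale_mult_right scale_sum word_mult bichar_Cons[of b "take i v" for i])
  with \<open>bichar [b] a = _\<close> show ?case
    by (simp add: sum.atMost_Suc_shift word_mult del: sum.atMost_Suc)
qed (simp add: word_Nil)

lemma word_shuffle_letter_right: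
  "word_shuffle v [a] = (\<Sum>i\<le>length v. scale (bichar (drop i v) a) (word (take i v @ [a] @ drop i v)))"
proof (induction v)
  case (Cons b v)
  have "word [b] * word_shuffle v [a]
    = (\<Sum>i\<le>length v. scale (bichar (drop i v) a) (word (b # take i v @ [a] @ drop i v)))"
    unfolding Cons by (simp add: sum_distrib_left scale_mult_right word_mult)
  then show ?case
    by (simp add: sum.atMost_Suc_shift word_mult bichar_def word_shuffle_Nil_right add.commute del: sum.atMost_Suc)
qed (simp add: word_Nil)

lemma is_catalan_iff: "is_catalan w \<longleftrightarrow> height w = 0 \<and> (\<forall>k. 0 \<le> height (take k w))"
proof -
  have "0 \<le> height (take k w)" if "is_catalan w" for k
  proof (cases "k \<in> {1..length w}")
    case False
    then have "k = 0 \<or> take k w = w" by auto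
    then show ?thesis using that by (auto simp: is_catalan_def)
  qed (use that in \<open>auto simp: is_catalan_def\<close>)
  then show ?thesis by (auto simp: is_catalan_def)
qed

lemma insert_in_Cat:
  assumes "v \<in> Cat n" "i \<le> length v"
  shows "take i v @ [X] @ drop i v @ [Y] \<in> Cat (Suc n)"
proof -
  have v: "height v = 0" "0 \<le> height (take k v)" for k
    using assms by (auto simp: Cat_def is_catalan_iff)
  have split: "height (take i v) + height (take m (drop i v)) = height (take (i + m) v)" for m
    by (simp add: take_add)
  have total: "height (take i v) + height (drop i v) = 0"
    using v(1) by (metis append_take_drop_id height_simps(3))
  have "0 \<le> height (take k (take i v @ [X] @ drop i v @ [Y]))" for k
  proof (cases "k \<le> i")
    case True
    then show ?thesis using v(2)[of k] assms(2) by (simp add: min_def)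
  next
    case False
    define m where "m = k - Suc i"
    have k: "k = Suc (i + m)" using False by (simp add: m_def)
    have "0 \<le> 1 + height (take m' [Y])" for m' by (cases m') auto
    then show ?thesis
      using v(2)[of "i + m"] split[of m] assms(2)
      by (simp add: k algebra_simps) (smt (verit, ccfv_SIG))
  qed
  then show ?thesis
    using assms total by (auto simp: Cat_def is_catalan_iff)
qed

text \<open>In a word of height zero a suffix and the prefix before it have opposite heights. The coefficients of the two
one-letter shuffles are therefore inverse powers of \<open>q\<close> up to sign, and their combination is the
coefficient in the recursion for Catalan words. The length of the word is even, so prefix and suffix
have the same sign.\<close>

lemma insertion_coeff:
  assumes "v \<in> Cat n" and that: "i \<le> length v"
  shows "nrm * (q2i * bichar (drop i v) X - q2 * bichar (take i v) X)
    = (- 1) ^ i * brace (2 + 2 * height (take i v))"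
proof -
  define h where "h = height (take i v)"
  have "height (take i v) + height (drop i v) = height v"
    by (metis append_take_drop_id height_simps(3))
  then have "height (drop i v) = - h"
    using assms by (simp add: h_def Cat_def is_catalan_def)
  moreover have "(- 1) ^ (length v - i) = ((- 1) ^ i :: Fq)"
    using assms that by (auto simp: Cat_def minus_one_power_iff)
  ultimately have "bichar (drop i v) X = (- 1) ^ i * q powi (- 2 * h)"
    "bichar (take i v) X = (- 1) ^ i * q powi (2 * h)"
    using that by (simp_all add: bichar_X h_def min_def)
  moreover have "q2i * q powi (- 2 * h) = q powi (- (2 + 2 * h))"
    by (simp add: q2i_def flip: power_int_add)
  moreover have "q2 * q powi (2 * h) = q powi (2 + 2 * h)"
    using power_int_add[of q 2 "2 * h"] by (simp add: q2_def)
  ultimately have "q2i * bichar (drop i v) X - q2 * bichar (take i v) X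
      = (- 1) ^ i * (q powi (- (2 + 2 * h)) - q powi (2 + 2 * h))"
    by (simp only: mult.left_commute[of q2i] mult.left_commute[of q2] right_diff_distrib)
  moreover have "even (2 + 2 * h)" by simp
  ultimately show ?thesis
    by (simp add: brace_def nrm_def h_def[symmetric] power_int_minus_one_minus power_int_minus_left)
qed

lemma lookup_Cs:
  "Poly_Mapping.lookup (Cs n) w = (if w \<in> Cat n then Cs_coeff n w else 0)"
  by (simp add: Cs_def lookup_sum lookup_scale lookup_word finite_Cat if_distrib cong: if_cong)

lemma Cs_0: "Cs 0 = 1"
proof -
  have "Cat 0 = {[]}" by (auto simp: Cat_def is_catalan_def)
  then show ?thesis by (simp add: Cs_def word_Nil)
qed

lemma qshuffle_sum_left: "(\<Sum>i\<in>A. f i) \<star> g = (\<Sum>i\<in>A. f i \<star> g)"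
  by (induction A rule: infinite_finite_induct) (simp_all add: qshuffle_linear)

lemma qshuffle_sum_right: "g \<star> (\<Sum>i\<in>A. f i) = (\<Sum>i\<in>A. g \<star> f i)"
  by (induction A rule: infinite_finite_induct) (simp_all add: qshuffle_linear)

text \<open>The recursion inserts an \<open>X\<close> at all positions and appends a \<open>Y\<close>. By the preceding computation the
insertion is a combination of the two shuffle products with \<open>X\<close>. This is the only property of the
coefficients of \<open>Cs\<close>, besides its initial value, on which the later arguments rest.\<close>

lemma Cs_Suc:
  "Cs (Suc n) = scale nrm (scale q2i (Cs n \<star> word [X]) - scale q2 (word [X] \<star> Cs n)) * word [Y]"
proof -
  have ins: "scale nrm (scale q2i (word v \<star> word [X]) - scale q2 (word [X] \<star> word v)) * word [Y]
    = (\<Sum>i\<le>length v. scale ((- 1) ^ i * brace (2 + 2 * height (take i v)))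
        (word (take i v @ [X] @ drop i v @ [Y])))" if "v \<in> Cat n" for v
  proof -
    have "scale nrm (scale q2i (word v \<star> word [X]) - scale q2 (word [X] \<star> word v))
      = (\<Sum>i\<le>length v. scale (nrm * (q2i * bichar (drop i v) X - q2 * bichar (take i v) X))
          (word (take i v @ [X] @ drop i v)))"
      unfolding qshuffle_word word_shuffle_letter_left word_shuffle_letter_right
      by (rule poly_mapping_eqI)
        (simp add: lookup_scale lookup_minus lookup_sum sum_distrib_left sum_subtractf[symmetric] algebra_simps)
    also have "\<dots> = (\<Sum>i\<le>length v. scale ((- 1) ^ i * brace (2 + 2 * height (take i v)))
        (word (take i v @ [X] @ drop i v)))"
      using insertion_coeff[OF that] by (intro sum.cong) auto
    finally show ?thesis
      by (simp add: sum_distrib_right scale_mult_left word_mult)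
  qed
  have "scale nrm (scale q2i (Cs n \<star> word [X]) - scale q2 (word [X] \<star> Cs n)) * word [Y]
    = (\<Sum>v\<in>Cat n. scale (Cs_coeff n v)
        (scale nrm (scale q2i (word v \<star> word [X]) - scale q2 (word [X] \<star> word v)) * word [Y]))"
    by (simp add: Cs_def qshuffle_sum_left qshuffle_sum_right qshuffle_linear scale_sum
        scale_diff sum_distrib_right sum_subtractf left_diff_distrib scale_mult_left ac_simps)
  also have "\<dots> = (\<Sum>v\<in>Cat n. scale (Cs_coeff n v)
      (\<Sum>i\<le>length v. scale ((- 1) ^ i * brace (2 + 2 * height (take i v)))
        (word (take i v @ [X] @ drop i v @ [Y]))))" (is "_ = ?S")
    by (simp add: ins)
  also have "\<dots> = Cs (Suc n)"
  proof (rule poly_mapping_eqI)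
    fix w
    have S: "Poly_Mapping.lookup ?S w = (\<Sum>v\<in>Cat n. Cs_coeff n v *
        (\<Sum>i\<le>length v. if take i v @ [X] @ drop i v @ [Y] = w
          then (- 1) ^ i * brace (2 + 2 * height (take i v)) else 0))"
      by (simp add: lookup_sum lookup_scale lookup_word if_distrib cong: if_cong)
    show "Poly_Mapping.lookup ?S w = Poly_Mapping.lookup (Cs (Suc n)) w"
    proof (cases "w \<in> Cat (Suc n)")
      case True
      have "(\<Sum>i\<le>length v. if take i v @ [X] @ drop i v @ [Y] = w then f i else 0)
        = (\<Sum>i\<in>{i. i \<le> length v \<and> w = take i v @ [X] @ drop i v @ [Y]}. f i)" for v and f :: "nat \<Rightarrow> Fq"
        by (rule sum.mono_neutral_cong_right) auto
      then show ?thesis using True by (simp only: S lookup_Cs if_True Cs_coeff.simps)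
    next
      case False
      then have "take i v @ [X] @ drop i v @ [Y] \<noteq> w" if "v \<in> Cat n" "i \<le> length v" for v i
        using insert_in_Cat[OF that] by auto
      then show ?thesis using False unfolding S lookup_Cs
        by (auto intro!: sum.neutral)
    qed
  qed
  finally show ?thesis by simp
qed

section \<open>Derivatives of the Catalan elements\<close>

abbreviation x :: V where "x \<equiv> word [X]"
abbreviation y :: V where "y \<equiv> word [Y]"

lemma q2i_less_q2: "q2i < q2"
proof -
  have "1 < q2" using one_less_q by (simp add: q2_def one_less_power)
  moreover have "q2i = inverse q2" by (simp add: q2i_def q2_def power_int_minus)
  ultimately show ?thesis
    using inverse_less_1_iff[of q2] less_trans[of q2i 1 q2] by simp
qed

lemma q2_neq [simp]: "q2 \<noteq> q2i" "q2i \<noteq> q2" "q2 ^ 2 \<noteq> q2i ^ 2"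
proof -
  show "q2 \<noteq> q2i" "q2i \<noteq> q2" using q2i_less_q2 by simp_all
  have "0 < q2i" "0 < q2" using one_less_q by (auto simp: q2i_def q2_def)
  then have "q2i ^ 2 < q2 ^ 2" using q2i_less_q2 by (intro power_strict_mono) auto
  then show "q2 ^ 2 \<noteq> q2i ^ 2" by simp
qed

lemma bichar_values [simp]:
  "bichar [X] X = - q2" "bichar [Y] Y = - q2" "bichar [X] Y = - q2i" "bichar [Y] X = - q2i"
  by (simp_all add: bichar_letter q2_def q2i_def)

declare word_Nil [simp] scale_minus [simp]

lemma scale_uminus_left [simp]: "scale (- a) f = - scale a f"
  by (rule poly_mapping_eqI) (simp add: lookup_scale)

lemma twist_mult_letter: "twist a (f * word [b]) = scale (bichar [b] a) (twist a f * word [b])"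
  by (induction f rule: V_induct)
    (simp_all add: distrib_right scale_mult_left word_mult scale_add bichar_append mult.commute)

text \<open>Removing the last letter commutes with prepending a letter, except at the empty word, whose
prepended letter is also the last one.\<close>

lemma rdel_letter_mult:
  "rdel a (word [b] * f) = word [b] * rdel a f + scale (if a = b then const_coeff f else 0) 1"
proof (induction f rule: V_induct)
  case (word u)
  show ?case
  proof (cases u rule: rev_cases)
    case Nil
    then show ?thesis
      using rdel_word(2)[of a "[]" b] by (simp add: word_Nil)
  next
    case (snoc v d)
    then show ?thesis
      using rdel_word(2)[of a "b # v" d] by (simp add: word_mult)
  qed
qed (simp_all add: distrib_left scale_mult_right scale_add scale_left_add)

lemma rdel_letter [simp]: "rdel a (word [b]) = (if a = b then 1 else 0)"
  using rdel_word(2)[of a "[]" b] by (simp add: word_Nil)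

lemma rdel_Cs:
  "rdel X (Cs n) = 0"
  "rdel Y (Cs (Suc n)) = scale nrm (scale q2i (Cs n \<star> x) - scale q2 (x \<star> Cs n))"
  by (cases n) (simp_all add: Cs_0 Cs_Suc)

lemma const_Cs: "const_coeff (Cs (Suc n)) = 0"
  by (simp add: Cs_Suc)

text \<open>Catalan words contain both letters equally often, and the factors of the two letters are inverse to
each other.\<close>

lemma twist_Cs [simp]: "twist a (Cs n) = Cs n"
proof (induction n)
  case (Suc n)
  have "twist a (Cs (Suc n)) = scale (bichar [X] a * bichar [Y] a) (Cs (Suc n))"
    by (simp add: Cs_Suc twist_mult_letter twist_qshuffle Suc qshuffle_linear scale_diff
        scale_mult_left left_diff_distrib ac_simps)
  also have "bichar [X] a * bichar [Y] a = 1" by (cases a) simp_all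
  finally show ?case by simp
qed (simp add: Cs_0)

definition xroot :: "nat \<Rightarrow> V" where
  "xroot n = x * Cs n"

text \<open>Prepending \<open>X\<close> to the derivative of \<open>Cs (Suc n)\<close> gives \<open>x * (Cs n \<star> x)\<close> and \<open>x * (x \<star> Cs n)\<close>. The left
derivatives express these by shuffle products with \<open>xroot n\<close>, up to multiples of \<open>x * xroot n\<close> that cancel.\<close>

lemma rdel_xroot:
  "rdel a (xroot 0) = (if a = X then 1 else 0)"
  "rdel X (xroot (Suc n)) = 0"
  "rdel Y (xroot (Suc n)) = scale nrm (scale q2i (xroot n \<star> x) + x \<star> xroot n)"
proof -
  show "rdel a (xroot 0) = (if a = X then 1 else 0)"
    by (simp add: xroot_def Cs_0)
  show "rdel X (xroot (Suc n)) = 0"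
    by (simp add: xroot_def rdel_letter_mult rdel_Cs const_Cs)
  have 1: "xroot n \<star> x = x * (Cs n \<star> x) - scale q2 (x * xroot n)"
    by (rule V_eqI_ldel) (simp_all add: xroot_def ldel_qshuffle twist_letter_mult qshuffle_linear)
  have 2: "x \<star> xroot n = x * xroot n - scale q2 (x * (x \<star> Cs n))"
    by (rule V_eqI_ldel) (simp_all add: xroot_def ldel_qshuffle twist_letter_mult qshuffle_linear)
  have "rdel Y (xroot (Suc n)) = scale nrm (scale q2i (x * (Cs n \<star> x)) - scale q2 (x * (x \<star> Cs n)))"
    by (simp add: xroot_def rdel_letter_mult rdel_Cs scale_mult_right right_diff_distrib)
  then show "rdel Y (xroot (Suc n)) = scale nrm (scale q2i (xroot n \<star> x) + x \<star> xroot n)"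
    unfolding 1 2 by (simp add: scale_diff)
qed

section \<open>Root vectors by iterated commutators\<close>

lemmas pointwise = poly_mapping_eq_iff fun_eq_iff lookup_add lookup_minus lookup_scale

definition ad :: "V \<Rightarrow> V" where
  "ad f = Cs 1 \<star> f - f \<star> Cs 1"

lemma ad_linear [simp]:
  "ad (f + g) = ad f + ad g" "ad (f - g) = ad f - ad g" "ad (scale a f) = scale a (ad f)"
  "ad (- f) = - ad f" "ad 0 = 0" "ad 1 = 0" "ad (Cs 1) = 0"
  by (simp_all add: ad_def qshuffle_linear scale_diff)

lemma ad_qshuffle [simp]: "ad (f \<star> g) = ad f \<star> g + f \<star> ad g"
  by (simp add: ad_def qshuffle_linear qshuffle_assoc)

lemma rdel_C1: "rdel Y (Cs 1) = scale (- nrm * (q2 - q2i)) x"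
  using rdel_Cs(2)[of 0] by (simp add: Cs_0 pointwise algebra_simps)

text \<open>The Catalan element \<open>Cs 1\<close> is invariant under the twists and has derivative a multiple of \<open>x\<close>. The deviation of
\<open>rdel Y\<close> from commuting with \<open>ad\<close> is therefore a twisted commutator with \<open>x\<close>.\<close>

lemma rdel_ad:
  "rdel X (ad f) = ad (rdel X f)"
  "rdel Y (ad f) = ad (rdel Y f) - scale (nrm * (q2 - q2i)) (x \<star> twist Y f - f \<star> x)"
  by (simp_all add: ad_def rdel_qshuffle rdel_Cs rdel_C1 qshuffle_linear pointwise algebra_simps
      del: One_nat_def)

text \<open>These will turn out to be the elements \<open>xroot n\<close>. Defined by iterated commutators, they come with a
derivation that raises their index before anything is known about their derivatives.\<close>

primrec Xit :: "nat \<Rightarrow> V" where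
  "Xit 0 = x"
| "Xit (Suc n) = scale (1 / (q2 - q2i)) (ad (Xit n))"

lemma ad_Xit: "ad (Xit n) = scale (q2 - q2i) (Xit (Suc n))"
  by simp

declare Xit.simps(2) [simp del]

lemma twist_Xit [simp]: "twist a (Xit n) = scale (bichar [X] a) (Xit n)"
  by (induction n) (simp_all add: Xit.simps ad_def twist_qshuffle qshuffle_linear scale_diff mult.commute)

lemma const_Xit [simp]: "const_coeff (Xit n) = 0"
  by (induction n) (simp_all add: Xit.simps ad_def)

lemma rdel_X_Xit [simp]: "rdel X (Xit (Suc n)) = 0"
proof (induction n)
  case (Suc n)
  show ?case by (subst Xit.simps(2)) (simp add: rdel_ad Suc)
qed (simp add: Xit.simps(2) rdel_ad)

definition q_anticomm :: "nat \<Rightarrow> nat \<Rightarrow> V" where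
  "q_anticomm a b = Xit a \<star> Xit b + scale q2i (Xit b \<star> Xit a)"

text \<open>The quadratic relations of the introduction: \<open>quad_rel a b\<close> will be shown to vanish.\<close>

definition quad_rel :: "nat \<Rightarrow> nat \<Rightarrow> V" where
  "quad_rel a b = q_anticomm (Suc a) b + q_anticomm (Suc b) a"

lemma rdel_Y_Xit_1: "rdel Y (Xit (Suc 0)) = scale nrm (scale q2i (x \<star> x) + x \<star> x)"
  by (simp add: Xit.simps rdel_ad qshuffle_linear,
     simp add: pointwise) (simp add: algebra_simps)

text \<open>The \<open>X\<close>-derivatives of the two summands are opposite multiples of \<open>Xit 1\<close>, and the \<open>Y\<close>-derivatives are
opposite multiples of the cube of \<open>x\<close>. The signs come from the twists.\<close>

lemma q_anticomm_1_0: "q_anticomm (Suc 0) 0 = 0"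
proof (rule V_eqI_rdel)
  fix a show "rdel a (q_anticomm (Suc 0) 0) = rdel a 0"
    by (cases a) (simp_all add: q_anticomm_def rdel_qshuffle qshuffle_linear qshuffle_assoc rdel_Y_Xit_1 scale_add,
      (simp add: pointwise algebra_simps)?)
qed (simp add: q_anticomm_def)

text \<open>These will turn out to be the Catalan elements \<open>Cs (Suc n)\<close>.\<close>

definition Ccomm :: "nat \<Rightarrow> V" where
  "Ccomm n = scale (- nrm) (scale q2 (Xit n \<star> y) + y \<star> Xit n)"

lemma twist_Ccomm [simp]: "twist a (Ccomm n) = Ccomm n"
  by (cases a) (simp_all add: Ccomm_def twist_qshuffle qshuffle_linear)

lemma const_Ccomm [simp]: "const_coeff (Ccomm n) = 0"
  by (simp add: Ccomm_def)

lemma rdel_X_Ccomm [simp]: "rdel X (Ccomm n) = 0"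
  by (cases n) (simp_all add: Ccomm_def rdel_qshuffle qshuffle_linear)

lemma Ccomm_0: "Ccomm 0 = Cs 1"
proof (rule V_eqI_rdel)
  fix a show "rdel a (Ccomm 0) = rdel a (Cs 1)"
    using rdel_C1
    by (cases a) (simp_all add: rdel_Cs Ccomm_def rdel_qshuffle qshuffle_linear pointwise algebra_simps)
qed (simp add: const_Cs)

text \<open>The derivative formula for \<open>Xit\<close> enters as an assumption because it is known at first only for
\<open>n = 0\<close>, and the general case relies on consequences of this instance.\<close>

lemma rdel_Y_Ccomm_Suc:
  assumes "rdel Y (Xit (Suc n)) = scale nrm (scale q2i (Xit n \<star> x) + x \<star> Xit n)"
  shows "rdel Y (Ccomm (Suc n)) = scale nrm (scale q2i (Ccomm n \<star> x) - scale q2 (x \<star> Ccomm n))"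
proof -
  have D: "rdel Y (Ccomm (Suc n)) = scale (- nrm) (scale (q2 - q2i) (Xit (Suc n))
      - scale (q2 * q2) (rdel Y (Xit (Suc n)) \<star> y) + y \<star> rdel Y (Xit (Suc n)))"
    by (simp add: Ccomm_def rdel_qshuffle qshuffle_linear pointwise algebra_simps)
  \<comment> \<open>Writing the element as a commutator turns all terms into products of \<open>x\<close>, \<open>y\<close> and \<open>Xit n\<close>.\<close>
  have "scale (q2 - q2i) (Xit (Suc n)) = Ccomm 0 \<star> Xit n - Xit n \<star> Ccomm 0"
    by (simp flip: ad_Xit add: ad_def Ccomm_0)
  then have a: "scale (q2 - q2i) (Xit (Suc n)) =
     scale (- nrm) (scale q2 (x \<star> (y \<star> Xit n)) + y \<star> (x \<star> Xit n)
       - scale q2 (Xit n \<star> (x \<star> y)) - Xit n \<star> (y \<star> x))"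
    by (simp add: Ccomm_def qshuffle_linear qshuffle_assoc pointwise algebra_simps)
  show ?thesis unfolding D a assms unfolding Ccomm_def
    apply (simp add: qshuffle_linear qshuffle_assoc scale_add scale_diff)
    apply (simp add: pointwise)
    apply (intro allI)
    using q2i_q2(1) by algebra
qed

text \<open>Expanding both sides leaves words in \<open>Xit i\<close>, \<open>Xit m\<close> and \<open>y\<close>. Those with \<open>y\<close> in the middle agree;
the remaining ones have \<open>y\<close> at an end next to a \<open>q\<close>-anticommutator. Note that \<open>i\<close> and \<open>m\<close>
exchange their places on the right.\<close>

lemma commutator_Xit_Ccomm:
  "Xit i \<star> Ccomm m - Ccomm m \<star> Xit i = scale q2i (Ccomm i \<star> Xit m) - scale q2 (Xit m \<star> Ccomm i)
    - scale nrm (scale (q2 * q2) (q_anticomm m i \<star> y) - y \<star> q_anticomm m i)"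
  unfolding Ccomm_def q_anticomm_def
  apply (simp add: qshuffle_linear qshuffle_assoc scale_add scale_diff)
  apply (simp add: pointwise)
  apply (intro allI)
  using q2i_q2(1) by algebra

section \<open>Quadratic relations\<close>

lemma commutator_x_Ccomm_1: "x \<star> Ccomm 1 - Ccomm 1 \<star> x = scale q2i (Cs 1 \<star> Xit 1) - scale q2 (Xit 1 \<star> Cs 1)"
  using commutator_Xit_Ccomm[of 0 1] by (simp add: q_anticomm_1_0 Ccomm_0)

text \<open>The commutator with \<open>Cs 1\<close> has vanishing constant coefficient and \<open>X\<close>-derivative, and its
\<open>Y\<close>-derivative is a multiple of the difference of the two sides of the exchange relation. It
is applied with \<open>f\<close> and \<open>g\<close> consecutive Catalan elements.\<close>

lemma ad_eq_0_iff_commutator: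
  assumes "rdel Y f = scale nrm (scale q2i (g \<star> x) - scale q2 (x \<star> g))" "rdel X f = 0" "twist Y f = f"
    and "const_coeff f = 0" "ad g = 0"
  shows "ad f = 0 \<longleftrightarrow> x \<star> f - f \<star> x = scale q2i (g \<star> Xit 1) - scale q2 (Xit 1 \<star> g)"
proof -
  have "rdel Y (ad f) = scale (nrm * (q2 - q2i))
      ((scale q2i (g \<star> Xit 1) - scale q2 (Xit 1 \<star> g)) - (x \<star> f - f \<star> x))"
    using ad_Xit[of 0]
    by (simp add: rdel_ad assms qshuffle_linear scale_diff ac_simps)
  moreover have "ad f = 0 \<longleftrightarrow> rdel Y (ad f) = 0"
  proof
    assume *: "rdel Y (ad f) = 0"
    show "ad f = 0"
    proof (rule V_eqI_rdel)
      fix a show "rdel a (ad f) = rdel a 0"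
        using * by (cases a) (simp_all add: rdel_ad(1) assms)
    qed (simp add: ad_def)
  qed simp
  ultimately show ?thesis
    by (auto simp: scale_eq_0_iff)
qed

lemma ad_Ccomm_1: "ad (Ccomm 1) = 0"
  using commutator_x_Ccomm_1 rdel_Y_Ccomm_Suc[of 0] rdel_Y_Xit_1
  by (subst ad_eq_0_iff_commutator[of _ "Cs 1"]) (simp_all add: Ccomm_0 del: One_nat_def, simp_all add: Ccomm_0)

text \<open>Apply the derivation \<open>ad\<close>, which annihilates \<open>f\<close> and \<open>g\<close>.\<close>

lemma commutator_shift:
  assumes "Xit i \<star> f - f \<star> Xit i = scale q2i (g \<star> Xit j) - scale q2 (Xit j \<star> g)" "ad f = 0" "ad g = 0"
  shows "Xit (Suc i) \<star> f - f \<star> Xit (Suc i) = scale q2i (g \<star> Xit (Suc j)) - scale q2 (Xit (Suc j) \<star> g)"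
proof -
  have "scale (q2 - q2i) (Xit (Suc i) \<star> f - f \<star> Xit (Suc i)) = ad (Xit i \<star> f - f \<star> Xit i)"
    by (simp add: assms(2) ad_Xit qshuffle_linear scale_diff)
  also have "\<dots> = ad (scale q2i (g \<star> Xit j) - scale q2 (Xit j \<star> g))"
    by (simp only: assms(1))
  also have "\<dots> = scale (q2 - q2i) (scale q2i (g \<star> Xit (Suc j)) - scale q2 (Xit (Suc j) \<star> g))"
    by (simp add: assms(3) ad_Xit qshuffle_linear scale_diff mult.commute)
  finally have "scale (1 / (q2 - q2i)) (scale (q2 - q2i) (Xit (Suc i) \<star> f - f \<star> Xit (Suc i))) =
    scale (1 / (q2 - q2i)) (scale (q2 - q2i) (scale q2i (g \<star> Xit (Suc j)) - scale q2 (Xit (Suc j) \<star> g)))"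
    by (simp only:)
  then show ?thesis by simp
qed

lemma commutator_Xit_Ccomm_1:
  "Xit i \<star> Ccomm 1 - Ccomm 1 \<star> Xit i = scale q2i (Cs 1 \<star> Xit (Suc i)) - scale q2 (Xit (Suc i) \<star> Cs 1)"
proof (induction i)
  case 0
  show ?case using commutator_x_Ccomm_1 by simp
next
  case (Suc i)
  then show ?case by (rule commutator_shift) (simp_all only: ad_Ccomm_1 ad_linear)
qed

text \<open>The subtracted square is chosen so that the commutator with \<open>Xit i\<close> is a pure multiple of
\<open>Xit (i + 2)\<close>; the commutator of \<open>Ccomm 1\<close> alone also contains \<open>Xit (Suc i) \<star> Cs 1\<close>. Thus \<open>Heis\<close>
plays the role of the second element of a Heisenberg algebra, the first being \<open>Cs 1\<close>.\<close>

definition Heis :: V where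
  "Heis = scale 2 (Ccomm 1) - Cs 1 \<star> Cs 1"

lemma commutator_Xit_Heis: "Heis \<star> Xit i - Xit i \<star> Heis = scale (q2i ^ 2 - q2 ^ 2) (Xit (i + 2))"
proof -
  let ?C = "Cs 1"
  have 1: "?C \<star> Xit j = Xit j \<star> ?C + scale (q2 - q2i) (Xit (Suc j))" for j
    using ad_Xit[of j] by (simp add: ad_def algebra_simps)
  have "?C \<star> (?C \<star> Xit i) = ?C \<star> (Xit i \<star> ?C + scale (q2 - q2i) (Xit (Suc i)))"
    by (simp only: 1)
  also have "\<dots> = (?C \<star> Xit i) \<star> ?C + scale (q2 - q2i) (?C \<star> Xit (Suc i))"
    by (simp add: qshuffle_linear qshuffle_assoc)
  also have "\<dots> = Xit i \<star> (?C \<star> ?C) + scale (2 * (q2 - q2i)) (Xit (Suc i) \<star> ?C)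
      + scale ((q2 - q2i) ^ 2) (Xit (i + 2))"
    unfolding 1 by (simp add: qshuffle_linear qshuffle_assoc, simp add: pointwise power2_eq_square algebra_simps)
  finally have 2: "?C \<star> (?C \<star> Xit i) = Xit i \<star> (?C \<star> ?C) + scale (2 * (q2 - q2i)) (Xit (Suc i) \<star> ?C)
      + scale ((q2 - q2i) ^ 2) (Xit (i + 2))" .
  have 3: "Ccomm 1 \<star> Xit i = Xit i \<star> Ccomm 1 + scale (q2 - q2i) (Xit (Suc i) \<star> ?C) - scale (q2i * (q2 - q2i)) (Xit (i + 2))"
    using commutator_Xit_Ccomm_1[of i]
    unfolding 1 by (simp add: pointwise algebra_simps)
  show ?thesis
    unfolding Heis_def qshuffle_linear 3 qshuffle_assoc 2
    by (simp add: pointwise power2_eq_square algebra_simps)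
qed

lemma quad_rel_commute: "quad_rel a b = quad_rel b a"
  by (simp add: quad_rel_def add.commute)

lemma ad_quad_rel: "ad (quad_rel a b) = scale (q2 - q2i) (quad_rel (Suc a) b + quad_rel a (Suc b))"
  by (simp add: quad_rel_def q_anticomm_def ad_Xit qshuffle_linear scale_add mult.commute)

lemma commutator_Heis_quad_rel: "Heis \<star> quad_rel a b - quad_rel a b \<star> Heis = scale (q2i ^ 2 - q2 ^ 2) (quad_rel (a + 2) b + quad_rel a (b + 2))"
proof -
  have 1: "Heis \<star> (Xit i \<star> Xit j) - (Xit i \<star> Xit j) \<star> Heis
    = scale (q2i ^ 2 - q2 ^ 2) (Xit (i + 2) \<star> Xit j + Xit i \<star> Xit (j + 2))" for i j
  proof -
    have "Heis \<star> (Xit i \<star> Xit j) - (Xit i \<star> Xit j) \<star> Heis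
      = (Heis \<star> Xit i - Xit i \<star> Heis) \<star> Xit j + Xit i \<star> (Heis \<star> Xit j - Xit j \<star> Heis)"
      by (simp add: qshuffle_linear qshuffle_assoc)
    then show ?thesis unfolding commutator_Xit_Heis by (simp add: qshuffle_linear scale_add)
  qed
  have 2: "Heis \<star> q_anticomm i j - q_anticomm i j \<star> Heis
    = scale (q2i ^ 2 - q2 ^ 2) (q_anticomm (i + 2) j + q_anticomm i (j + 2))" for i j
  proof -
    have "Heis \<star> q_anticomm i j - q_anticomm i j \<star> Heis = (Heis \<star> (Xit i \<star> Xit j) - (Xit i \<star> Xit j) \<star> Heis)
      + scale q2i (Heis \<star> (Xit j \<star> Xit i) - (Xit j \<star> Xit i) \<star> Heis)"
      by (simp add: q_anticomm_def qshuffle_linear scale_diff)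
    then show ?thesis unfolding 1
      by (simp add: q_anticomm_def scale_add ac_simps)
  qed
  have "Heis \<star> quad_rel a b - quad_rel a b \<star> Heis = (Heis \<star> q_anticomm (Suc a) b - q_anticomm (Suc a) b \<star> Heis)
      + (Heis \<star> q_anticomm (Suc b) a - q_anticomm (Suc b) a \<star> Heis)"
    by (simp add: quad_rel_def qshuffle_linear)
  then show ?thesis unfolding 2 by (simp add: quad_rel_def scale_add)
qed

lemma V_double_zero: "f = - f \<Longrightarrow> f = (0 :: V)"
  by (auto simp: poly_mapping_eq_iff fun_eq_iff)

text \<open>Applying \<open>ad\<close> to a relation of total index \<open>n - 1\<close> shows that the elements of total index \<open>n\<close> agree
up to alternating signs. Together with the symmetry this settles \<open>n = 1\<close>. For larger \<open>n\<close>, going from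
\<open>quad_rel 0 n\<close> to \<open>quad_rel 2 (n - 2)\<close> by two such steps preserves the sign, while one step with \<open>Heis\<close>
changes it.\<close>

lemma quad_rel_0: "quad_rel a b = 0"
proof -
  have step: "quad_rel (Suc a) b = - quad_rel a (Suc b)" if "quad_rel a b = 0" for a b
    using ad_quad_rel[of a b] that by (auto simp: scale_eq_0_iff eq_neg_iff_add_eq_0)
  have step2: "quad_rel (a + 2) b = - quad_rel a (b + 2)" if "quad_rel a b = 0" for a b
    using commutator_Heis_quad_rel[of a b] that by (auto simp: scale_eq_0_iff eq_neg_iff_add_eq_0 dest: sym[of "q2i ^ 2"])
  have "\<forall>a b. a + b = n \<longrightarrow> quad_rel a b = 0" for n
  proof (induction n rule: less_induct)
    case (less n)
    then have lower: "quad_rel a b = 0" if "a + b < n" for a b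
      using that by blast
    have top: "quad_rel 0 n = 0"
    proof (cases "n = 0")
      case True
      then show ?thesis by (simp add: quad_rel_def q_anticomm_1_0)
    next
      case False
      have "quad_rel 0 n = - quad_rel 0 n"
      proof (cases "n = 1")
        case True
        then have "quad_rel 1 0 = - quad_rel 0 1" using step[of 0 0] lower by simp
        then show ?thesis using quad_rel_commute[of 0 1] True by metis
      next
        case n: False
        define m where "m = n - 2"
        have m: "n = m + 2" using False n by (simp add: m_def)
        have "quad_rel 0 (m + 2) = - quad_rel (Suc 0) (Suc m)"
          using step[of 0 "Suc m"] lower m by simp
        also have "\<dots> = quad_rel 2 m"
          using step[of 1 m] lower m by (simp add: numeral_2_eq_2)
        also have "\<dots> = - quad_rel 0 (m + 2)"
          using step2[of 0 m] lower m by (simp add: numeral_2_eq_2)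
        finally show ?thesis unfolding m .
      qed
      then show ?thesis by (rule V_double_zero)
    qed
    have "quad_rel a b = 0" if "a + b = n" for a b
      using that
    proof (induction a arbitrary: b)
      case (Suc a)
      then show ?case using step[of a b] lower by auto
    qed (use top in simp)
    then show ?case by blast
  qed
  then show ?thesis by blast
qed

section \<open>Identification of the root vectors and the exchange relation\<close>

text \<open>Differentiating \<open>ad (Xit (Suc n))\<close> yields the expected expression plus the quadratic relation
\<open>quad_rel 0 n\<close>.\<close>

lemma rdel_Y_Xit: "rdel Y (Xit (Suc n)) = scale nrm (scale q2i (Xit n \<star> x) + x \<star> Xit n)"
proof (induction n)
  case 0
  show ?case using rdel_Y_Xit_1 by simp
next
  case (Suc n)
  have "scale (q2 - q2i) (rdel Y (Xit (Suc (Suc n)))) = rdel Y (ad (Xit (Suc n)))"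
    by (simp add: ad_Xit)
  also have "\<dots> = scale (nrm * (q2 - q2i)) (scale q2i (Xit (Suc n) \<star> x) + x \<star> Xit (Suc n) + quad_rel 0 n)"
    unfolding rdel_ad(2) Suc using ad_Xit[of 0]
    by (simp add: ad_Xit qshuffle_linear quad_rel_def q_anticomm_def,
       simp add: pointwise algebra_simps)
  finally have "scale (1 / (q2 - q2i)) (scale (q2 - q2i) (rdel Y (Xit (Suc (Suc n))))) = scale (1 / (q2 - q2i))
     (scale (nrm * (q2 - q2i)) (scale q2i (Xit (Suc n) \<star> x) + x \<star> Xit (Suc n) + quad_rel 0 n))"
    by (simp only:)
  then show ?case by (simp add: quad_rel_0)
qed

lemma xroot_eq_Xit: "xroot n = Xit n"
proof (induction n)
  case 0
  show ?case by (simp add: xroot_def Cs_0)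
next
  case (Suc n)
  show ?case
  proof (rule V_eqI_rdel)
    fix a show "rdel a (xroot (Suc n)) = rdel a (Xit (Suc n))"
      by (cases a) (simp_all add: rdel_xroot rdel_Y_Xit Suc)
  qed (simp add: xroot_def)
qed

lemma Cs_Suc_eq_Ccomm: "Cs (Suc n) = Ccomm n"
proof (induction n)
  case 0
  show ?case using Ccomm_0 by simp
next
  case (Suc n)
  show ?case
  proof (rule V_eqI_rdel)
    fix a show "rdel a (Cs (Suc (Suc n))) = rdel a (Ccomm (Suc n))"
      by (cases a) (simp_all add: rdel_Cs Suc rdel_Y_Ccomm_Suc[OF rdel_Y_Xit])
  qed (simp add: const_Cs)
qed

text \<open>The two instances of the commutator formula contain the \<open>q\<close>-anticommutators of a quadratic
relation, which cancel.\<close>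

lemma commutator_sum:
  "(Xit i \<star> Ccomm (Suc m) - Ccomm (Suc m) \<star> Xit i) + (Xit m \<star> Ccomm (Suc i) - Ccomm (Suc i) \<star> Xit m)
  = (scale q2i (Ccomm i \<star> Xit (Suc m)) - scale q2 (Xit (Suc m) \<star> Ccomm i))
  + (scale q2i (Ccomm m \<star> Xit (Suc i)) - scale q2 (Xit (Suc i) \<star> Ccomm m))"
proof -
  have "q_anticomm (Suc m) i = - q_anticomm (Suc i) m"
    using quad_rel_0[of m i] by (simp add: quad_rel_def eq_neg_iff_add_eq_0)
  then show ?thesis
    unfolding commutator_Xit_Ccomm by (simp add: qshuffle_linear scale_diff)
qed

text \<open>The preceding sum pairs this relation with the one for \<open>Ccomm 1\<close>, which is already established.\<close>

lemma commutator_x_Cs: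
  "x \<star> Cs (Suc j) - Cs (Suc j) \<star> x = scale q2i (Cs j \<star> Xit 1) - scale q2 (Xit 1 \<star> Cs j)"
proof (cases j)
  case 0
  have "x \<star> Cs 1 - Cs 1 \<star> x = - scale (q2 - q2i) (Xit 1)"
    using ad_Xit[of 0] by (simp add: ad_def algebra_simps)
  then show ?thesis using 0 by (simp add: Cs_0 pointwise algebra_simps)
next
  case (Suc m)
  show ?thesis
    using commutator_sum[of 0 m] commutator_Xit_Ccomm_1[of m]
    by (simp add: Suc Cs_Suc_eq_Ccomm)
qed

lemma ad_Cs: "ad (Cs j) = 0"
proof (induction j)
  case (Suc j)
  then show ?case
    using commutator_x_Cs[of j]
    by (subst ad_eq_0_iff_commutator[of _ "Cs j"]) (simp_all add: rdel_Cs const_Cs)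
qed (simp add: Cs_0)

text \<open>All Catalan elements commute with \<open>Cs 1\<close>, so the index \<open>i\<close> can be raised from zero.\<close>

lemma commutator_xroot_Cs:
  "xroot i \<star> Cs (Suc j) - Cs (Suc j) \<star> xroot i
  = scale q2i (Cs j \<star> xroot (Suc i)) - scale q2 (xroot (Suc i) \<star> Cs j)"
  unfolding xroot_eq_Xit
proof (induction i)
  case 0
  show ?case using commutator_x_Cs[of j] by simp
next
  case (Suc i)
  then show ?case by (rule commutator_shift) (simp_all add: ad_Cs)
qed

text \<open>The exchange relation is rearranged so that the commutator of \<open>xroot (Suc i)\<close> with \<open>Cs j\<close> appears
with the factor \<open>- q2i\<close>. The rest is the first summand, and the factor accounts for the shift of the
summation index.\<close>

lemma xroot_Cs_expansion:
  "xroot i \<star> Cs j - Cs j \<star> xroot i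
  = scale (q2 - q2i) (\<Sum>l = 1..j. scale ((- 1) ^ l * q powi (2 - 2 * int l)) (xroot (i + l) \<star> Cs (j - l)))"
proof (induction j arbitrary: i)
  case 0
  show ?case by (simp add: Cs_0)
next
  case (Suc j)
  define T where "T l = scale ((- 1) ^ l * q powi (2 - 2 * int l)) (xroot (i + l) \<star> Cs (Suc j - l))" for l
  have coeff: "(- 1) ^ Suc l * q powi (2 - 2 * int (Suc l)) = - q2i * ((- 1) ^ l * q powi (2 - 2 * int l))" for l
  proof -
    have "q powi (2 - 2 * int (Suc l)) = q2i * q powi (2 - 2 * int l)"
      unfolding q2i_def by (subst power_int_add[symmetric]) (simp_all add: algebra_simps)
    then show ?thesis by simp
  qed
  have T_Suc: "T (Suc l) = - scale q2i (scale ((- 1) ^ l * q powi (2 - 2 * int l)) (xroot (Suc i + l) \<star> Cs (j - l)))" for l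
    unfolding T_def coeff by simp
  have "xroot i \<star> Cs (Suc j) - Cs (Suc j) \<star> xroot i =
      - scale q2i (xroot (Suc i) \<star> Cs j - Cs j \<star> xroot (Suc i)) + scale (q2 - q2i) (T 1)"
    unfolding commutator_xroot_Cs by (simp add: T_def pointwise algebra_simps)
  also have "\<dots> = scale (q2 - q2i) (\<Sum>l = 1..j. T (Suc l)) + scale (q2 - q2i) (T 1)"
    unfolding Suc T_Suc by (simp add: sum_negf scale_sum ac_simps)
  also have "\<dots> = scale (q2 - q2i) (\<Sum>l = 1..Suc j. T l)"
  proof -
    have "(\<Sum>l = 1..Suc j. T l) = T 1 + (\<Sum>l = Suc 1..Suc j. T l)"
      by (rule sum.atLeast_Suc_atMost) simp
    also have "(\<Sum>l = Suc 1..Suc j. T l) = (\<Sum>l = 1..j. T (Suc l))"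
      by (rule sum.shift_bounds_cl_Suc_ivl)
    finally show ?thesis by (simp only: scale_add add.commute)
  qed
  finally show ?case unfolding T_def .
qed

section \<open>The antiautomorphism\<close>

fun swap :: "letter \<Rightarrow> letter" where
  "swap X = Y" | "swap Y = X"

lemma swap_swap [simp]: "swap (swap a) = a" and swap_comp_swap [simp]: "swap \<circ> swap = id"
  by (cases a; simp) (rule ext, case_tac x, simp_all)

definition flip_word :: "word \<Rightarrow> word" where
  "flip_word w = map swap (rev w)"

definition zeta :: "V \<Rightarrow> V" where
  "zeta f = Poly_Mapping.map_key flip_word f"

lemma flip_word_flip_word [simp]: "flip_word (flip_word w) = w"
  by (simp add: flip_word_def rev_map)

lemma flip_word_simps [simp]: "flip_word [] = []" "flip_word [a] = [swap a]" "flip_word (u @ v) = flip_word v @ flip_word u"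
  by (simp_all add: flip_word_def)

lemma lookup_zeta: "Poly_Mapping.lookup (zeta f) w = Poly_Mapping.lookup f (flip_word w)"
proof -
  have "inj flip_word" by (metis flip_word_flip_word injI)
  then show ?thesis by (simp add: zeta_def map_key.rep_eq)
qed

lemma zeta_linear [simp]:
  "zeta (f + g) = zeta f + zeta g" "zeta (f - g) = zeta f - zeta g"
  "zeta (- f) = - zeta f" "zeta (scale a f) = scale a (zeta f)" "zeta 0 = 0"
  by (simp_all add: pointwise lookup_zeta)

lemma zeta_sum: "zeta (\<Sum>i\<in>A. f i) = (\<Sum>i\<in>A. zeta (f i))"
  by (induction A rule: infinite_finite_induct) simp_all

lemma zeta_word [simp]: "zeta (word w) = word (flip_word w)"
  by (rule poly_mapping_eqI) (auto simp: lookup_zeta lookup_word)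

lemma zeta_mult: "zeta (f * g) = zeta g * zeta f"
proof (induction f rule: V_induct)
  case (word u)
  show ?case
    by (induction g rule: V_induct)
      (simp_all add: distrib_left distrib_right scale_mult_left scale_mult_right word_mult)
qed (simp_all add: distrib_left distrib_right scale_mult_left scale_mult_right)

lemma bichar_flip: "bichar (flip_word w) (swap a) = bichar w a"
proof -
  have "form (swap b) (swap a) = form b a" for b by (cases a; cases b) (simp_all add: form_def)
  then show ?thesis by (simp add: bichar_def flip_word_def rev_map[symmetric] sum_list_rev o_def)
qed

lemma rdel_zeta: "rdel (swap a) (zeta f) = zeta (ldel a f)"
  by (rule poly_mapping_eqI) (simp add: lookup_rdel lookup_zeta lookup_ldel)

lemma twist_zeta: "twist (swap a) (zeta f) = zeta (twist a f)"
  using bichar_flip[of "flip_word w" a for w]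
  by (intro poly_mapping_eqI) (simp add: lookup_twist lookup_zeta)

lemma const_zeta: "const_coeff (zeta f) = const_coeff f"
  by (simp add: const_coeff_def lookup_zeta)

text \<open>The symmetry turns left derivatives into right derivatives, and the rules for the two on products
are mirror images of each other.\<close>

lemma zeta_qshuffle_word: "zeta (word u \<star> word v) = zeta (word v) \<star> zeta (word u)"
proof (induction "length u + length v" arbitrary: u v rule: less_induct)
  case less
  have u: "zeta (ldel a (word u) \<star> word v) = zeta (word v) \<star> zeta (ldel a (word u))" for a
    by (rule ldel_word_cases[of a u], simp, simp only:, subst less, auto)
  have v: "zeta (word u \<star> ldel a (word v)) = zeta (ldel a (word v)) \<star> zeta (word u)" for a
    by (rule ldel_word_cases[of a v], simp, simp only:, subst less, auto)
  show ?case
  proof (rule V_eqI_rdel)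
    fix b
    define a where "a = swap b"
    have b: "b = swap a" by (simp add: a_def)
    have "rdel b (zeta (word u \<star> word v))
      = zeta (ldel a (word u) \<star> word v) + scale (bichar u a) (zeta (word u \<star> ldel a (word v)))"
      by (simp add: b rdel_zeta ldel_qshuffle qshuffle_linear del: zeta_word ldel_word)
    also have "\<dots> = rdel b (zeta (word v) \<star> zeta (word u))"
      unfolding u v rdel_qshuffle b rdel_zeta twist_zeta
      by (simp add: qshuffle_linear del: zeta_word ldel_word)
    finally show "rdel b (zeta (word u \<star> word v)) = rdel b (zeta (word v) \<star> zeta (word u))" .
  qed (simp add: const_zeta del: zeta_word)
qed

lemma zeta_qshuffle: "zeta (f \<star> g) = zeta g \<star> zeta f"
proof (induction f rule: V_induct)
  case (word u)
  show ?case
    by (induction g rule: V_induct)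
      (simp_all add: qshuffle_linear zeta_qshuffle_word del: zeta_word)
qed (simp_all add: qshuffle_linear)

lemma zeta_Cs_1: "zeta (Cs 1) = Cs 1"
proof -
  have "Cs 1 = scale (- nrm * (q2 - q2i)) (x * y)"
    using Cs_Suc[of 0] by (simp add: Cs_0 pointwise algebra_simps scale_mult_left left_diff_distrib)
  then show ?thesis by (simp add: zeta_mult)
qed

definition Yit :: "nat \<Rightarrow> V" where
  "Yit n = zeta (Xit n)"

lemma ad_zeta: "ad (zeta f) = - zeta (ad f)"
  using zeta_Cs_1 by (simp add: ad_def zeta_qshuffle)

lemma ad_Yit: "ad (Yit n) = - scale (q2 - q2i) (Yit (Suc n))"
  by (simp add: Yit_def ad_zeta ad_Xit)

text \<open>The case \<open>b = 0\<close> is the formula for \<open>Cs\<close> with \<open>y\<close>. Since \<open>ad\<close> annihilates the left-hand side, raises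
the index of \<open>Xit\<close>, and raises that of \<open>Yit\<close> with the opposite sign, an index can be moved from one
factor to the other.\<close>

lemma Cs_eq_Xit_Yit: "Cs (Suc (a + b)) = scale (- nrm) (scale q2 (Xit a \<star> Yit b) + Yit b \<star> Xit a)"
proof (induction b arbitrary: a)
  case 0
  show ?case using Cs_Suc_eq_Ccomm[of a] by (simp add: Ccomm_def Yit_def)
next
  case (Suc b)
  have "0 = ad (Cs (Suc (a + b)))" by (simp add: ad_Cs)
  also have "\<dots> = scale (q2 - q2i) (Cs (Suc (Suc a + b))
      - scale (- nrm) (scale q2 (Xit a \<star> Yit (Suc b)) + Yit (Suc b) \<star> Xit a))"
    unfolding Suc by (simp add: ad_Xit ad_Yit qshuffle_linear, simp add: pointwise algebra_simps)
  finally show ?case by (auto simp: scale_eq_0_iff eq_neg_iff_add_eq_0)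
qed

text \<open>The symmetry exchanges the two extreme cases of the preceding formula, in which one of the indices is zero.\<close>

lemma zeta_Cs: "zeta (Cs n) = Cs n"
proof (cases n)
  case 0
  then show ?thesis by (simp add: Cs_0 flip: word_Nil)
next
  case (Suc m)
  have "zeta (Cs n) = scale (- nrm) (scale q2 (zeta y \<star> zeta (Xit m)) + zeta (Xit m) \<star> zeta y)"
    by (simp add: Suc Cs_Suc_eq_Ccomm Ccomm_def zeta_qshuffle del: zeta_word)
  also have "\<dots> = Cs n"
    using Cs_eq_Xit_Yit[of 0 m] by (simp add: Suc Yit_def)
  finally show ?thesis .
qed

theorem corollary53:
  fixes i j :: nat
  shows
    "scale (1 / (q ^ 2 - q powi (-2))) ((word [X] * Cs i) \<star> Cs j - Cs j \<star> (word [X] * Cs i))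
      = (\<Sum>l = 1..j. scale ((-1) ^ l * q powi (2 - 2 * int l))
          ((word [X] * Cs (i + l)) \<star> Cs (j - l)))
   \<and> scale (1 / (q ^ 2 - q powi (-2))) (Cs j \<star> (Cs i * word [Y]) - (Cs i * word [Y]) \<star> Cs j)
      = (\<Sum>l = 1..j. scale ((-1) ^ l * q powi (2 - 2 * int l))
          (Cs (j - l) \<star> (Cs (i + l) * word [Y])))"
proof -
  have first: "scale (1 / (q2 - q2i)) ((x * Cs i) \<star> Cs j - Cs j \<star> (x * Cs i))
    = (\<Sum>l = 1..j. scale ((-1) ^ l * q powi (2 - 2 * int l)) ((x * Cs (i + l)) \<star> Cs (j - l)))"
    using xroot_Cs_expansion[of i j] by (simp add: xroot_def)
  have "zeta (x * Cs k) = Cs k * y" for k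
    by (simp add: zeta_mult zeta_Cs)
  then have "scale (1 / (q2 - q2i)) (Cs j \<star> (Cs i * y) - (Cs i * y) \<star> Cs j)
    = (\<Sum>l = 1..j. scale ((-1) ^ l * q powi (2 - 2 * int l)) (Cs (j - l) \<star> (Cs (i + l) * y)))"
    using arg_cong[OF first, of zeta] by (simp add: zeta_sum zeta_qshuffle zeta_Cs)
  with first show ?thesis by (simp only: q2_def q2i_def)
qed

end
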